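(* Let $0<\alpha<n$, let $A$ be an invertible real $n\times n$ matrix, and define $$T_Af(x)=\int_{\mathbb{R}^n}\frac{1}{|x-Ay|^{n-\alpha}}\,f(y)\,dy .$$ Let $p:\mathbb{R}^n\to[1,\infty)$ be a measurable function with $p_+<\frac n\alpha$ such that $p$ is continuous at $y_0$ and at $Ay_0$ for some $y_0\in\mathbb{R}^n$, and let $q(\cdot)$ be defined by $\frac1{q(\cdot)}=\frac1{p(\cdot)}-\frac{\alpha}{n}$. If $p(Ay_0)>p(y_0)$, then there exists $f\in L^{p(\cdot)}(\mathbb{R}^n)$ such that $T_Af\notin L^{q(\cdot)}(\mathbb{R}^n)$.
   Context: For a measurable function $p:\mathbb{R}^n\to[1,\infty)$, $p_+=\operatorname{ess\,sup}p$. The variable exponent space $L^{p(\cdot)}(\mathbb{R}^n)$ is the Banach space of measurable functions $f$ on $\mathbb{R}^n$ such that $\int (|f(x)|/\lambda)^{p(x)}dx<\infty$ for some $\lambda>0$, with norm $\|f\|_{p(\cdot)}=\inf\{\lambda>0:\int (|f(x)|/\lambda)^{p(x)}dx\le1\}$; $L^{q(\cdot)}(\mathbb{R}^n)$ is defined in the same way. *)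

theory Defs
  imports "HOL-Analysis.Analysis" "HOL-Probability.Essential_Supremum"
begin

(* The modular of the variable exponent space, as a Lebesgue integral in [0,\<infinity>].
   Since 0 powr r = 0, the integrand vanishes where f does. *)
definition modular :: "(real ^ 'n \<Rightarrow> real) \<Rightarrow> (real ^ 'n \<Rightarrow> real) \<Rightarrow> ennreal"
  where "modular p f = (\<integral>\<^sup>+ x. ennreal (\<bar>f x\<bar> powr p x) \<partial>lebesgue)"

definition var_Lp :: "(real ^ 'n \<Rightarrow> real) \<Rightarrow> (real ^ 'n \<Rightarrow> real) set"
  where "var_Lp p =
    {f \<in> borel_measurable lebesgue. \<exists>l>0. modular p (\<lambda>x. f x / l) < \<infinity>}"

(* A Bochner integral, hence 0 at points x where the integrand is not integrable.
   For f in the space of exponent p with 1 \<le> p and ess sup p < n/\<alpha> such points form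
   a null set, so this convention does not affect membership of the result in any
   variable exponent space. The value 1/0 = 0 of the kernel is taken at one point y only
   when A is invertible. *)
definition T_op :: "real \<Rightarrow> real ^ 'n ^ 'n \<Rightarrow> (real ^ 'n \<Rightarrow> real) \<Rightarrow> real ^ 'n \<Rightarrow> real"
  where "T_op \<alpha> A f x =
    (\<integral>y. 1 / norm (x - A *v y) powr (real CARD('n) - \<alpha>) * f y \<partial>lebesgue)"

end

theory Submission
  imports Defs "HOL-Real_Asymp.Real_Asymp"
begin

text \<open>
  Near \<open>y0\<close> take \<open>f y = norm (y - y0) powr -\<beta>\<close> with \<open>n / p (A y0) < \<beta> < n / p y0\<close>. The upper bound on
  \<open>\<beta>\<close> makes \<open>f\<close> lie in the space of exponent \<open>p\<close>. On the ball of radius \<open>d = norm (x - A y0)\<close> around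
  \<open>y0\<close> the kernel is at least of order \<open>d powr (\<alpha> - n)\<close> and \<open>f\<close> at least \<open>d powr -\<beta>\<close>, so the image of
  \<open>f\<close> at \<open>x\<close> is at least of order \<open>d powr (\<alpha> - \<beta>)\<close>. Since \<open>\<beta> - \<alpha> > n / p (A y0) - \<alpha> = n / q (A y0)\<close>,
  its \<open>q\<close>-modular diverges at \<open>A y0\<close>, whatever the scaling.
\<close>

section \<open>Integrals of powers of the norm over balls\<close>

lemma emeasure_ball_scale:
  fixes c :: "'a::euclidean_space"
  assumes "0 \<le> r"
  shows "emeasure lborel (ball c r) = ennreal (r powr DIM('a) * measure lborel (ball (0::'a) 1))"
proof -
  have "emeasure lborel (ball c r) = ennreal (measure lborel (ball c r))"
    by (metis emeasure_eq_ennreal_measure emeasure_lborel_ball_finite infinity_ennreal_def less_irrefl)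
  also have "measure lborel (ball c r) = r powr DIM('a) * measure lborel (ball (0::'a) 1)"
    using assms by (subst content_ball_conv_unit_ball) (auto simp: powr_realpow le_less)
  finally show ?thesis .
qed

lemma le_suminf_ennreal: "f k \<le> (\<Sum>i. f i)" for f :: "nat \<Rightarrow> ennreal"
  using sum_le_suminf[of f "{k}"] by simp

text \<open>The shell with radii \<open>u (Suc k)\<close> and \<open>u k\<close> contributes at most
  \<open>C * \<rho> ^ k\<close>, and \<open>\<rho> < 1\<close> because \<open>\<gamma>\<close> is
  below the dimension. Each shell is enlarged to the full ball of radius \<open>u k\<close>, which
  affects only the constant.\<close>

lemma integrable_norm_powr_ball:
  fixes c :: "'a::euclidean_space" and \<gamma> r :: real
  assumes \<gamma>: "0 \<le> \<gamma>" "\<gamma> < DIM('a)" and r: "0 < r"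
  shows "integrable lborel (\<lambda>y. indicator (ball c r) y * norm (y - c) powr - \<gamma>)"
proof -
  define u where "u k = r * (1/2) ^ k" for k :: nat
  define V where "V = measure lborel (ball (0::'a) 1)"
  define C where "C = (r/2) powr - \<gamma> * (r powr DIM('a) * V)"
  define \<rho> where "\<rho> = (1/2) powr (DIM('a) - \<gamma>)"
  have u_pos: "0 < u k" for k using r by (simp add: u_def)
  have V: "0 \<le> V" by (simp add: V_def)
  have \<rho>: "0 \<le> \<rho>" "\<rho> < 1" using \<gamma> by (auto simp: \<rho>_def powr01_less_one)
  \<comment> \<open>Dyadic shells: the point \<open>y\<close> lies between the radii \<open>u (Suc k)\<close> and \<open>u k\<close> for some \<open>k\<close>.\<close>
  have bound: "indicator (ball c r) y * norm (y - c) powr - \<gamma>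
      \<le> (\<Sum>k. ennreal (u (Suc k) powr - \<gamma>) * indicator (ball c (u k)) y)" (is "_ \<le> suminf ?g") for y
  proof (cases "y \<in> ball c r \<and> y \<noteq> c")
    case True
    define d where "d = norm (y - c)"
    have d: "0 < d" "d < r" using True by (auto simp: d_def dist_norm norm_minus_commute)
    have "\<exists>k. (1/2::real) ^ k < d / r" using d by (intro real_arch_pow_inv) auto
    then obtain k where "u k < d" using d by (auto simp: u_def field_simps)
    moreover have "u (Suc k) \<le> u k" using r by (simp add: u_def)
    ultimately have "\<exists>k. u (Suc k) \<le> d" by (intro exI[of _ k]) simp
    \<comment> \<open>Minimality of \<open>k\<close> supplies the upper bound
      \<open>d < u k\<close>; for \<open>k = 0\<close> this is \<open>d < r\<close>.\<close>
    define k where "k = (LEAST k. u (Suc k) \<le> d)"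
    have k: "u (Suc k) \<le> d" unfolding k_def by (rule LeastI_ex) fact
    have k': "d < u k"
    proof (cases k)
      case 0 then show ?thesis using d by (simp add: u_def)
    next
      case (Suc j)
      then have "\<not> u (Suc j) \<le> d" unfolding k_def by (metis lessI not_less_Least)
      then show ?thesis using Suc by simp
    qed
    have "d powr - \<gamma> \<le> u (Suc k) powr - \<gamma>"
      using k u_pos \<gamma> by (intro powr_mono2') auto
    then have "ennreal (indicator (ball c r) y * norm (y - c) powr - \<gamma>) \<le> ?g k"
      using True k' by (auto simp: d_def dist_norm norm_minus_commute intro!: ennreal_leI)
    also have "\<dots> \<le> suminf ?g"
      using le_suminf_ennreal[of ?g k] .
    finally show ?thesis .
  \<comment> \<open>At \<open>y = c\<close> the left side is 0, since
    \<open>0 powr - \<gamma> = 0\<close>.\<close>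
  qed (auto)
  have "(\<integral>\<^sup>+ y. indicator (ball c r) y * norm (y - c) powr - \<gamma> \<partial>lborel)
      \<le> (\<integral>\<^sup>+ y. (\<Sum>k. ennreal (u (Suc k) powr - \<gamma>) * indicator (ball c (u k)) y) \<partial>lborel)"
    by (intro nn_integral_mono bound)
  also have "\<dots> = (\<Sum>k. ennreal (u (Suc k) powr - \<gamma>) * emeasure lborel (ball c (u k)))"
    by (subst nn_integral_suminf)
      (simp_all only: nn_integral_cmult_indicator sets_lborel borel_open open_ball
        borel_measurable_times_ennreal borel_measurable_const borel_measurable_indicator)
  also have "\<dots> = (\<Sum>k. ennreal (C * \<rho> ^ k))"
  proof (rule suminf_cong)
    fix k
    have "u (Suc k) = (r/2) * (1/2) powr k"
      by (simp add: u_def powr_realpow)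
    then have "u (Suc k) powr - \<gamma> = (r/2) powr - \<gamma> * (1/2) powr (- \<gamma> * k)"
      using r by (simp only: powr_mult powr_powr) (simp add: mult_ac)
    moreover have "u k powr DIM('a) = r powr DIM('a) * (1/2) powr (DIM('a) * k)"
      using r by (auto simp: u_def powr_mult powr_powr powr_realpow[symmetric] mult_ac)
    moreover have "\<rho> ^ k = (1/2) powr (- \<gamma> * k) * (1/2) powr (DIM('a) * k)"
      by (simp add: \<rho>_def powr_add[symmetric] powr_powr powr_realpow[symmetric] algebra_simps)
    ultimately show "ennreal (u (Suc k) powr - \<gamma>) * emeasure lborel (ball c (u k)) = ennreal (C * \<rho> ^ k)"
      using u_pos[of k] V by (subst emeasure_ball_scale)
        (auto simp: C_def V_def[symmetric] ennreal_mult[symmetric] mult_ac)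
  qed
  also have "\<dots> < \<infinity>"
    using \<rho> V by (subst suminf_ennreal2)
      (auto intro!: summable_mult simp: C_def summable_geometric)
  finally have fin: "(\<integral>\<^sup>+ y. indicator (ball c r) y * norm (y - c) powr - \<gamma> \<partial>lborel) < \<infinity>" .
  show ?thesis
  proof (rule integrableI_bounded)
    show "(\<lambda>y. indicator (ball c r) y * norm (y - c) powr - \<gamma>) \<in> borel_measurable lborel"
      by (intro borel_measurable_times borel_measurable_indicator powr_real_measurable
          borel_measurable_norm borel_measurable_diff borel_measurable_const) simp_all
  qed (use fin in \<open>simp add: abs_mult\<close>)
qed

text \<open>One small ball at a time suffices: on \<open>ball c s\<close>, off the centre,
  \<open>g\<close> is at least \<open>C * s powr - \<gamma>\<close>, so the integral is at least a
  constant times \<open>s powr (DIM('a) - \<gamma>)\<close>, which is unbounded as \<open>s\<close>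
  tends to 0. Only monotonicity of the integral enters, so the result applies to \<open>T_op\<close>
  without a discussion of measurability.\<close>

lemma nn_integral_norm_powr_ball_eq_top:
  fixes c :: "'a::euclidean_space" and \<gamma> r C :: real
  assumes \<gamma>: "DIM('a) < \<gamma>" and r: "0 < r" and C: "0 < C"
    and g: "\<And>x. x \<noteq> c \<Longrightarrow> norm (x - c) < r \<Longrightarrow> ennreal (C * norm (x - c) powr - \<gamma>) \<le> g x"
  shows "(\<integral>\<^sup>+ x. g x \<partial>lborel) = \<infinity>"
proof -
  define V where "V = measure lborel (ball (0::'a) 1)"
  have V: "0 < V" unfolding V_def by (rule content_ball_pos) simp
  have le: "ennreal (C * V * s powr (DIM('a) - \<gamma>)) \<le> (\<integral>\<^sup>+ x. g x \<partial>lborel)" if s: "0 < s" "s \<le> r" for s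
  proof -
    have "ennreal (C * V * s powr (DIM('a) - \<gamma>)) = ennreal (C * s powr - \<gamma>) * emeasure lborel (ball c s)"
      using s V C by (subst emeasure_ball_scale)
        (auto simp: V_def[symmetric] ennreal_mult[symmetric] powr_diff powr_minus field_simps)
    also have "\<dots> = (\<integral>\<^sup>+ x. ennreal (C * s powr - \<gamma>) * indicator (ball c s) x \<partial>lborel)"
      by (simp add: nn_integral_cmult_indicator)
    also have "\<dots> \<le> (\<integral>\<^sup>+ x. g x \<partial>lborel)"
    proof (rule nn_integral_mono_AE)
      show "AE x in lborel. ennreal (C * s powr - \<gamma>) * indicator (ball c s) x \<le> g x"
        using AE_lborel_singleton[of c]
      proof eventually_elim
        case (elim x)
        show ?case
        proof (cases "x \<in> ball c s")
          case True
          then have *: "norm (x - c) < s" by (simp add: dist_norm norm_minus_commute)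
          have "C * s powr - \<gamma> \<le> C * norm (x - c) powr - \<gamma>"
            using * elim C \<gamma> by (intro mult_left_mono powr_mono2') auto
          then have "ennreal (C * s powr - \<gamma>) \<le> ennreal (C * norm (x - c) powr - \<gamma>)"
            by (rule ennreal_leI)
          also have "\<dots> \<le> g x" using * elim s by (intro g) auto
          finally show ?thesis using True by simp
        qed simp
      qed
    qed
    finally show ?thesis .
  qed
  have lim: "filterlim (\<lambda>s. C * V * s powr (DIM('a) - \<gamma>)) at_top (at_right 0)"
  proof (rule filterlim_tendsto_pos_mult_at_top[OF tendsto_const])
    show "0 < C * V" using C V by simp
    show "filterlim (\<lambda>s. s powr (DIM('a) - \<gamma>)) at_top (at_right 0)"
      using \<gamma> by real_asymp
  qed
  show ?thesis
  proof (rule ccontr)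
    assume "\<not> ?thesis"
    then obtain M where M: "(\<integral>\<^sup>+ x. g x \<partial>lborel) = ennreal M" "0 \<le> M"
      by (metis ennreal_cases infinity_ennreal_def)
    have "eventually (\<lambda>s. M < C * V * s powr (DIM('a) - \<gamma>) \<and> 0 < s \<and> s \<le> r) (at_right 0)"
      using lim r by (intro eventually_conj) 
       (auto simp: filterlim_at_top_dense eventually_at_right_less intro!: eventually_at_rightI[of 0 r])
    then obtain s where "M < C * V * s powr (DIM('a) - \<gamma>)" "0 < s" "s \<le> r"
      by (metis (no_types, lifting) eventually_happens trivial_limit_at_right_real)
    with le[of s] M show False by (simp add: ennreal_le_iff)
  qed
qed


section \<open>A pointwise lower bound near \<open>A *v y0\<close>\<close>

text \<open>One constant serves all \<open>x\<close>, because the exponents of the kernel, of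
  \<open>f\<close> and of the volume of \<open>ball y0 d\<close> add up exactly:
  \<open>- (n - \<alpha>) - \<beta> + n = - (\<beta> - \<alpha>)\<close>. Most of the work goes into
  the integrability of the product.\<close>

lemma T_op_norm_powr_lower_bound:
  fixes A :: "real ^ 'n ^ 'n" and y0 :: "real ^ 'n" and \<alpha> \<beta> r :: real
  assumes \<alpha>: "0 < \<alpha>" "\<alpha> < CARD('n)" and A: "invertible A"
    and \<beta>: "0 < \<beta>" "\<beta> < CARD('n)" and r: "0 < r"
  obtains C where "0 < C"
    and "\<And>x. x \<noteq> A *v y0 \<Longrightarrow> norm (x - A *v y0) < r \<Longrightarrow>
      C * norm (x - A *v y0) powr - (\<beta> - \<alpha>)
        \<le> T_op \<alpha> A (\<lambda>y. indicator (ball y0 r) y * norm (y - y0) powr - \<beta>) x"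
proof -
  define n where "n = real CARD('n)"
  define f where "f y = indicator (ball y0 r) y * norm (y - y0) powr - \<beta>" for y
  have lin: "linear ((*v) A)" by simp
  obtain L where L: "0 < L" "\<And>v. norm (A *v v) \<le> L * norm v"
    using linear_bounded_pos[OF lin] by blast
  obtain A' where A': "A ** A' = mat 1" "A' ** A = mat 1" using A unfolding invertible_def by blast
  \<comment> \<open>The lower bound for \<open>A\<close> controls the kernel by the distance from
    \<open>y\<close> to its singularity, the preimage \<open>z\<close> of \<open>x\<close>.\<close>
  obtain B where B: "0 < B" "\<And>v. B * norm v \<le> norm (A *v v)"
    by (rule linear_invertible_bounded_below_pos[OF lin, of "(*v) A'"])
      (auto simp: fun_eq_iff matrix_vector_mul_assoc A')
  define V where "V = measure lborel (ball (0::real^'n) 1)"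
  have V: "0 < V" unfolding V_def by (rule content_ball_pos) simp
  \<comment> \<open>On \<open>ball y0 d\<close> the triangle inequality gives
    \<open>norm (x - A *v y) \<le> (1 + L) * d\<close>, hence the factor
    \<open>1 + L\<close>.\<close>
  define C where "C = (1 + L) powr - (n - \<alpha>) * V"
  have f_int: "integrable lborel f"
    unfolding f_def using \<beta> r by (intro integrable_norm_powr_ball) auto
  have f_meas [measurable]: "f \<in> borel_measurable borel"
    using borel_measurable_integrable[OF f_int] by simp
  have f_nonneg: "0 \<le> f y" for y by (simp add: f_def)
  show ?thesis
  proof (rule that[of C])
    show "0 < C" using L V by (simp add: C_def)
    fix x assume x: "x \<noteq> A *v y0" "norm (x - A *v y0) < r"
    define d where "d = norm (x - A *v y0)"
    have d: "0 < d" "d < r" using x by (auto simp: d_def)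
    define K where "K y = 1 / norm (x - A *v y) powr (n - \<alpha>)" for y
    have K_eq: "K y = norm (x - A *v y) powr - (n - \<alpha>)" for y
      by (simp only: K_def powr_minus_divide)
    have K_meas [measurable]: "K \<in> borel_measurable borel"
    proof -
      have "continuous_on UNIV ((*v) A)"
        by (simp add: linear_continuous_on linear_linear)
      then have [measurable]: "(*v) A \<in> borel_measurable borel"
        by (rule borel_measurable_continuous_onI)
      show ?thesis unfolding K_def by measurable
    qed
    have K_nonneg: "0 \<le> K y" for y by (simp add: K_def)
    define z where "z = A' *v x"
    have Az: "A *v z = x" by (simp add: z_def matrix_vector_mul_assoc A')
    \<comment> \<open>At \<open>y = z\<close> both sides are 0, by the conventions for
      \<open>1 / 0\<close> and for powers of 0.\<close>
    have K_le: "K y \<le> B powr - (n - \<alpha>) * norm (y - z) powr - (n - \<alpha>)" for y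
    proof (cases "y = z")
      case False
      have "B * norm (y - z) \<le> norm (x - A *v y)"
        using B(2)[of "z - y"] by (simp add: matrix_vector_mult_diff_distrib Az norm_minus_commute)
      moreover have "0 < B * norm (y - z)" using False B by simp
      ultimately have "norm (x - A *v y) powr - (n - \<alpha>) \<le> (B * norm (y - z)) powr - (n - \<alpha>)"
        using \<alpha> by (intro powr_mono2') (auto simp: n_def)
      then show ?thesis using B by (simp add: K_eq powr_mult)
    qed (simp add: K_def Az)
    \<comment> \<open>For \<open>y\<close> within \<open>\<eta>\<close> of \<open>y0\<close>, the
      point \<open>A *v y\<close> is within \<open>d / 2\<close> of \<open>A *v y0\<close>, so it
      stays at distance at least \<open>d / 2\<close> from \<open>x\<close>.\<close>
    define \<eta> where "\<eta> = d / (2 * L)"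
    have \<eta>: "0 < \<eta>" using d L by (simp add: \<eta>_def)
    \<comment> \<open>Large enough for \<open>ball z R\<close> to contain \<open>ball y0 r\<close>,
      outside which \<open>f\<close> vanishes.\<close>
    define R where "R = r + norm (y0 - z) + 1"
    have R: "0 < R" using r by (simp add: R_def add_pos_nonneg)
    \<comment> \<open>The singularities of the kernel (at \<open>z\<close>) and of \<open>f\<close> (at \<open>y0\<close>) are apart, so one factor is
      always bounded. Without integrability the Bochner integral would be 0 by convention.\<close>
    define G where "G y = (d/2) powr - (n - \<alpha>) * f y
      + \<eta> powr - \<beta> * B powr - (n - \<alpha>) * (indicator (ball z R) y * norm (y - z) powr - (n - \<alpha>))" for y
    have "integrable lborel (\<lambda>y. indicator (ball z R) y * norm (y - z) powr - (n - \<alpha>))"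
      using \<alpha> R by (intro integrable_norm_powr_ball) (auto simp: n_def)
    then have G_int: "integrable lborel G"
      unfolding G_def using f_int by (intro Bochner_Integration.integrable_add integrable_mult_right)
    have Kf_le: "K y * f y \<le> G y" for y
    proof (cases "norm (y - y0) < \<eta>")
      case True
      have "d \<le> norm (x - A *v y) + norm (A *v (y - y0))"
        unfolding d_def matrix_vector_mult_diff_distrib by norm
      also have "norm (A *v (y - y0)) \<le> L * \<eta>"
        using L(2)[of "y - y0"] True L(1) by (meson less_imp_le mult_left_mono order_trans)
      finally have "d / 2 \<le> norm (x - A *v y)" using L by (simp add: \<eta>_def)
      then have "K y \<le> (d / 2) powr - (n - \<alpha>)"
        using d \<alpha> powr_mono2'[of "- (n - \<alpha>)" "d/2" "norm (x - A *v y)"]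
        by (simp add: K_eq n_def)
      then have "K y * f y \<le> (d / 2) powr - (n - \<alpha>) * f y"
        using f_nonneg by (rule mult_right_mono)
      also have "\<dots> \<le> G y" by (simp add: G_def)
      finally show ?thesis .
    next
      case False
      show ?thesis
      proof (cases "y \<in> ball y0 r")
        case True
        then have "norm (y - z) < R"
          unfolding R_def mem_ball dist_norm by norm
        then have ind: "indicator (ball z R) y = (1::real)"
          by (simp add: dist_norm norm_minus_commute)
        have "f y \<le> \<eta> powr - \<beta>"
          using True False \<eta> \<beta> by (auto simp: f_def intro: powr_mono2')
        then have "K y * f y \<le> (B powr - (n - \<alpha>) * norm (y - z) powr - (n - \<alpha>)) * \<eta> powr - \<beta>"
          using K_le K_nonneg f_nonneg by (intro mult_mono) auto
        moreover have "0 \<le> (d / 2) powr - (n - \<alpha>) * f y" using f_nonneg by simp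
        ultimately show ?thesis by (simp add: G_def ind mult_ac)
      qed (simp add: f_def G_def)
    qed
    have Kf_int: "integrable lborel (\<lambda>y. K y * f y)"
      using G_int by (rule Bochner_Integration.integrable_bound)
        (use Kf_le K_nonneg f_nonneg in \<open>auto simp: abs_mult intro!: AE_I2 order_trans[OF Kf_le]\<close>)
    define c where "c = ((1 + L) * d) powr - (n - \<alpha>) * d powr - \<beta>"
    \<comment> \<open>At \<open>y0\<close> and \<open>z\<close> the bound fails: \<open>f\<close> or
      \<open>K\<close> takes the default value 0 there, whereas \<open>c\<close> is positive. The
      two points form a null set.\<close>
    have c_le: "c \<le> K y * f y" if y: "y \<in> ball y0 d" "y \<noteq> y0" "y \<noteq> z" for y
    proof -
      have "norm (y - y0) < d" using y by (simp add: dist_norm norm_minus_commute)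
      have "norm (x - A *v y) \<le> d + norm (A *v (y - y0))"
        unfolding d_def matrix_vector_mult_diff_distrib by norm
      also have "norm (A *v (y - y0)) \<le> L * d"
        using L(2)[of "y - y0"] \<open>norm (y - y0) < d\<close> L(1) by (meson less_imp_le mult_left_mono order_trans)
      finally have *: "norm (x - A *v y) \<le> (1 + L) * d" by (simp add: algebra_simps)
      have "0 < B * norm (z - y)" using y B by simp
      also have "\<dots> \<le> norm (x - A *v y)" using B(2)[of "z - y"] by (simp add: matrix_vector_mult_diff_distrib Az)
      finally have "((1 + L) * d) powr - (n - \<alpha>) \<le> norm (x - A *v y) powr - (n - \<alpha>)"
        using * \<alpha> by (intro powr_mono2') (auto simp: n_def)
      then have "((1 + L) * d) powr - (n - \<alpha>) \<le> K y" by (simp only: K_eq)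
      moreover have "d powr - \<beta> \<le> f y"
        using y d \<open>norm (y - y0) < d\<close> \<beta> by (auto simp: f_def intro: powr_mono2')
      ultimately show ?thesis unfolding c_def by (intro mult_mono) (auto simp: K_nonneg)
    qed
    have "C * d powr - (\<beta> - \<alpha>) = c * measure lborel (ball y0 d)"
    proof -
      have "measure lborel (ball y0 d) = d powr n * V"
        using d by (subst content_ball_conv_unit_ball) (auto simp: V_def n_def powr_realpow)
      moreover have "d powr - (n - \<alpha>) * d powr - \<beta> * d powr n = d powr - (\<beta> - \<alpha>)"
        by (simp add: powr_add[symmetric])
      ultimately show ?thesis using d L by (simp add: C_def c_def powr_mult)
    qed
    also have "\<dots> = (\<integral>y. c * indicator (ball y0 d) y \<partial>lborel)"
      by simp
    also have "\<dots> \<le> (\<integral>y. K y * f y \<partial>lborel)"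
    proof (rule integral_mono_AE)
      show "integrable lborel (\<lambda>y. c * indicator (ball y0 d) y)"
        by (intro integrable_mult_right integrable_real_indicator) (simp_all add: emeasure_lborel_ball_finite[unfolded infinity_ennreal_def])
      show "AE y in lborel. c * indicator (ball y0 d) y \<le> K y * f y"
        using AE_lborel_singleton[of y0] AE_lborel_singleton[of z]
        by eventually_elim (use c_le K_nonneg f_nonneg in \<open>auto simp: indicator_def\<close>)
    qed (rule Kf_int)
    also have "\<dots> = T_op \<alpha> A f x"
      unfolding T_op_def K_def[symmetric] n_def[symmetric] by (rule integral_completion[symmetric]) simp
    finally show "C * norm (x - A *v y0) powr - (\<beta> - \<alpha>)
        \<le> T_op \<alpha> A (\<lambda>y. indicator (ball y0 r) y * norm (y - y0) powr - \<beta>) x"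
      by (simp add: d_def f_def[abs_def])
  qed
qed

section \<open>The value of \<open>p\<close> at a point of continuity and the choice of
  \<open>\<beta>\<close>\<close>

text \<open>Otherwise continuity would keep \<open>p\<close> above some \<open>m\<close> larger than
  the essential supremum on a whole ball, which has positive measure. This turns the bound on the
  essential supremum into \<open>p (A *v y0) < n / \<alpha>\<close>.\<close>

lemma le_esssup_at_isCont:
  fixes p :: "'a::euclidean_space \<Rightarrow> real"
  assumes "p \<in> borel_measurable lebesgue" "isCont p a"
  shows "ereal (p a) \<le> esssup lebesgue (\<lambda>x. ereal (p x))"
proof (rule ccontr)
  define M where "M = esssup lebesgue (\<lambda>x. ereal (p x))"
  assume "\<not> ?thesis"
  then have "M < ereal (p a)" by (simp add: M_def)
  then obtain m where m: "M < ereal m" "m < p a" by (metis ereal_dense2 less_ereal.simps(1))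
  have "eventually (\<lambda>x. m < p x) (nhds a)"
    using assms(2) m(2) by (intro order_tendstoD(1)[where y = "p a"])
      (auto simp: continuous_at tendsto_at_iff_tendsto_nhds)
  then obtain e where e: "0 < e" "\<And>x. dist x a < e \<Longrightarrow> m < p x"
    by (auto simp: eventually_nhds_metric)
  have "AE x in lebesgue. ereal (p x) \<le> M" unfolding M_def by (rule esssup_AE)
  then have "AE x in lebesgue. x \<notin> ball a e"
  proof eventually_elim
    case (elim x)
    show ?case
    proof
      assume "x \<in> ball a e"
      then have "m < p x" by (intro e(2)) (simp add: dist_commute)
      then show False using elim m(1) by (metis ereal_less_eq(3) leD less_le_trans linorder_not_less nless_le order_trans)
    qed
  qed
  then have "emeasure lborel (ball a e) = 0"
    unfolding AE_completion_iff by (subst (asm) AE_iff_null) (auto simp: null_sets_def ball_def)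
  then have "measure lborel (ball a e) = 0" by (simp add: measure_def)
  with content_ball_pos[OF e(1), of a] show False by simp
qed

theorem proposition4:
  fixes \<alpha> :: real
    and A :: "real ^ 'n ^ 'n"
    and p q :: "real ^ 'n \<Rightarrow> real"
    and y0 :: "real ^ 'n"
  assumes "0 < \<alpha>" and "\<alpha> < real CARD('n)"
    and "invertible A"
    and "p \<in> borel_measurable lebesgue" and "\<And>x. 1 \<le> p x"
    and "esssup lebesgue (\<lambda>x. ereal (p x)) < ereal (real CARD('n) / \<alpha>)"
    and "isCont p y0" and "isCont p (A *v y0)"
    and "\<And>x. 1 / q x = 1 / p x - \<alpha> / real CARD('n)"
    and "p (A *v y0) > p y0"
  shows "\<exists>f. f \<in> var_Lp p \<and> T_op \<alpha> A f \<notin> var_Lp q"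
proof -
  define n where "n = real CARD('n)"
  define a where "a = A *v y0"
  note n_pos = assms(1,2)[folded n_def]
  have p_pos: "0 < p x" for x using assms(5)[of x] by simp
  have "ereal (p a) < ereal (n / \<alpha>)"
    using le_less_trans[OF le_esssup_at_isCont[OF assms(4,8)] assms(6)] by (simp only: a_def n_def)
  then have pa: "\<alpha> < n / p a" using n_pos p_pos[of a] by (simp add: field_simps)
  have "n / p a < n / p y0"
    using assms(10) n_pos p_pos by (intro divide_strict_left_mono) (auto simp: a_def)
  then obtain \<beta> where \<beta>: "n / p a < \<beta>" "\<beta> < n / p y0" using dense by blast
  have \<beta>_pos: "0 < \<beta>" "\<alpha> < \<beta>" using \<beta> pa n_pos by auto
  \<comment> \<open>Since \<open>p y0\<close> is at least 1, \<open>\<beta>\<close> stays below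
    \<open>n\<close>, so \<open>f\<close> is integrable, as the lower bound for \<open>T_op\<close>
    requires.\<close>
  have "n / p y0 \<le> n" using assms(5)[of y0] n_pos by (simp add: divide_le_eq)
  then have \<beta>_less: "\<beta> < n" using \<beta> by simp

  \<comment> \<open>Membership of \<open>f\<close> in the space of exponent \<open>p\<close>\<close>
  have "\<beta> * p y0 < n" using \<beta>(2) p_pos[of y0] by (simp add: field_simps)
  \<comment> \<open>The constant \<open>\<gamma>\<close> dominates \<open>\<beta> * p x\<close> near
    \<open>y0\<close> by continuity, and the power with exponent \<open>- \<gamma>\<close> is still
    integrable there.\<close>
  then obtain \<gamma> where \<gamma>: "\<beta> * p y0 < \<gamma>" "\<gamma> < n" using dense by blast
  have \<gamma>_pos: "0 < \<gamma>" using \<gamma>(1) \<beta>_pos p_pos[of y0] by (meson mult_pos_pos order.strict_trans)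
  have "((\<lambda>x. \<beta> * p x) \<longlongrightarrow> \<beta> * p y0) (nhds y0)"
    using assms(7) by (intro tendsto_intros) (simp add: continuous_at tendsto_at_iff_tendsto_nhds)
  then have "eventually (\<lambda>x. \<beta> * p x < \<gamma>) (nhds y0)" using \<gamma>(1) by (rule order_tendstoD)
  then obtain r0 where r0: "0 < r0" "\<And>x. dist x y0 < r0 \<Longrightarrow> \<beta> * p x < \<gamma>"
    by (auto simp: eventually_nhds_metric)
  \<comment> \<open>For a norm at most 1, a larger \<open>\<gamma>\<close> gives a larger
    \<open>norm (y - y0) powr - \<gamma>\<close>; this allows the variable exponent to be replaced
    by the constant one.\<close>
  define r where "r = min r0 1"
  have r: "0 < r" "r \<le> 1" "r \<le> r0" using r0 by (auto simp: r_def)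
  define f where "f = (\<lambda>y. indicator (ball y0 r) y * norm (y - y0) powr - \<beta>)"
  have f_meas: "f \<in> borel_measurable borel"
    using borel_measurable_integrable[OF integrable_norm_powr_ball[of \<beta> r y0]] \<beta>_pos \<beta>_less r
    by (simp add: f_def n_def)
  have "modular p f \<le> (\<integral>\<^sup>+ y. ennreal (indicator (ball y0 r) y * norm (y - y0) powr - \<gamma>) \<partial>lborel)"
    unfolding modular_def nn_integral_completion
  proof (intro nn_integral_mono ennreal_leI)
    fix y
    show "\<bar>f y\<bar> powr p y \<le> indicator (ball y0 r) y * norm (y - y0) powr - \<gamma>"
    proof (cases "y \<in> ball y0 r \<and> y \<noteq> y0")
      case True
      then have "norm (y - y0) \<le> 1" "\<beta> * p y < \<gamma>"
        using r by (auto simp: dist_norm norm_minus_commute intro!: r0(2))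
      then have "norm (y - y0) powr - (\<beta> * p y) \<le> norm (y - y0) powr - \<gamma>"
        using True by (intro powr_mono') auto
      then show ?thesis using True by (simp add: f_def powr_powr)
    qed (auto simp: f_def)
  qed
  also have "\<dots> < \<infinity>"
    using integrable_norm_powr_ball[of \<gamma> r y0] \<gamma> \<gamma>_pos r
    by (auto simp: n_def integrable_iff_bounded abs_mult)
  finally have f_mem: "f \<in> var_Lp p"
    using f_meas by (auto simp: var_Lp_def intro!: exI[of _ 1] measurable_completion)

  \<comment> \<open>Divergence of the \<open>q\<close>-modular at \<open>A *v y0\<close>\<close>
  obtain C where C: "0 < C"
    and T_ge: "\<And>x. x \<noteq> a \<Longrightarrow> norm (x - a) < r \<Longrightarrow> C * norm (x - a) powr - (\<beta> - \<alpha>) \<le> T_op \<alpha> A f x"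
    using T_op_norm_powr_lower_bound[OF assms(1-3), of \<beta> r y0] \<beta>_pos \<beta>_less r
    unfolding a_def f_def n_def by auto

  \<comment> \<open>Inversion is an involution even at 0, so the points with
    \<open>1 / p x = \<alpha> / n\<close> are covered as well.\<close>
  have q_eq: "q x = 1 / (1 / p x - \<alpha> / n)" for x
    using assms(9)[of x] by (simp add: n_def flip: inverse_eq_divide) (metis inverse_inverse_eq)
  have qa: "0 < 1 / p a - \<alpha> / n" using pa n_pos p_pos[of a] by (simp add: field_simps)
  \<comment> \<open>The inequality \<open>n / p a < \<beta>\<close>, shifted by
    \<open>\<alpha>\<close>, reads \<open>n / q a < \<beta> - \<alpha>\<close>.\<close>
  have "n < (\<beta> - \<alpha>) * q a"
  proof -
    have "n * (1 / p a - \<alpha> / n) < \<beta> - \<alpha>" using \<beta>(1) n_pos by (simp add: algebra_simps)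
    then show ?thesis unfolding q_eq using qa by (simp add: pos_less_divide_eq)
  qed
  then have "n / (\<beta> - \<alpha>) < q a" using \<beta>_pos by (simp add: field_simps)
  \<comment> \<open>A constant exponent in the gap: \<open>s\<close> still forces divergence, and
    \<open>q\<close> exceeds it near \<open>a\<close> by continuity.\<close>
  then obtain s where s: "n / (\<beta> - \<alpha>) < s" "s < q a" using dense by blast
  have s_pos: "0 < s" using s(1) n_pos \<beta>_pos by (meson divide_pos_pos diff_gt_0_iff_gt less_trans)
  have s_gt: "n < (\<beta> - \<alpha>) * s" using s(1) \<beta>_pos by (simp add: field_simps)
  have "(q \<longlongrightarrow> q a) (nhds a)"
    unfolding q_eq[abs_def] using assms(8) qa p_pos[of a]
    by (intro tendsto_intros) (auto simp: continuous_at tendsto_at_iff_tendsto_nhds a_def)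
  then have "eventually (\<lambda>x. s < q x) (nhds a)" using s(2) by (rule order_tendstoD)
  then obtain r1 where r1: "0 < r1" "\<And>x. dist x a < r1 \<Longrightarrow> s < q x"
    by (auto simp: eventually_nhds_metric)

  have "modular q (\<lambda>x. T_op \<alpha> A f x / l) = \<infinity>" if l: "0 < l" for l
    unfolding modular_def nn_integral_completion
  \<comment> \<open>The last radius is the one at which the lower bound for
    \<open>T_op \<alpha> A f x / l\<close> equals 1. Closer to \<open>a\<close> this quotient is at
    least 1, so raising its exponent from \<open>s\<close> to \<open>q x\<close> can only increase
    the power. The scaling \<open>l\<close> thus changes only the radius and the constant.\<close>
  proof (rule nn_integral_norm_powr_ball_eq_top[where c = a and \<gamma> = "(\<beta> - \<alpha>) * s" and C = "(C / l) powr s"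
      and r = "min (min r r1) ((C / l) powr (1 / (\<beta> - \<alpha>)))"])
    show "real DIM(real ^ 'n) < (\<beta> - \<alpha>) * s" using s_gt by (simp add: n_def)
    show "0 < (C / l) powr s" using C l by simp
    show "0 < min (min r r1) ((C / l) powr (1 / (\<beta> - \<alpha>)))" using r r1 C l by simp
    fix x assume x: "x \<noteq> a" "norm (x - a) < min (min r r1) ((C / l) powr (1 / (\<beta> - \<alpha>)))"
    define d where "d = norm (x - a)"
    have d: "0 < d" "d < r" "d < r1" "d < (C / l) powr (1 / (\<beta> - \<alpha>))" using x by (auto simp: d_def)
    have "d powr (\<beta> - \<alpha>) \<le> ((C / l) powr (1 / (\<beta> - \<alpha>))) powr (\<beta> - \<alpha>)"
      using d \<beta>_pos by (intro powr_mono2) auto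
    also have "\<dots> = C / l" using C l \<beta>_pos by (simp add: powr_powr)
    finally have "1 \<le> C / l * d powr - (\<beta> - \<alpha>)"
      unfolding powr_minus_divide using d l by (simp add: field_simps)
    moreover have *: "C / l * d powr - (\<beta> - \<alpha>) \<le> T_op \<alpha> A f x / l"
      using divide_right_mono[OF T_ge[of x], of l] x d l by (simp add: d_def)
    ultimately have "1 \<le> T_op \<alpha> A f x / l" by simp
    have "(C / l) powr s * d powr - ((\<beta> - \<alpha>) * s) = (C / l * d powr - (\<beta> - \<alpha>)) powr s"
      using C l d by (subst powr_mult) (simp_all add: powr_powr algebra_simps)
    also have "\<dots> \<le> (T_op \<alpha> A f x / l) powr s"
      using * C l s_pos by (intro powr_mono2) auto
    also have "\<dots> \<le> (T_op \<alpha> A f x / l) powr q x"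
      using \<open>1 \<le> T_op \<alpha> A f x / l\<close> r1(2)[of x] d by (intro powr_mono) (auto simp: d_def dist_norm)
    finally show "ennreal ((C / l) powr s * norm (x - a) powr - ((\<beta> - \<alpha>) * s))
        \<le> ennreal (\<bar>T_op \<alpha> A f x / l\<bar> powr q x)"
      using \<open>1 \<le> T_op \<alpha> A f x / l\<close> by (intro ennreal_leI) (simp add: d_def del: abs_divide)
  qed
  then have "T_op \<alpha> A f \<notin> var_Lp q" by (auto simp: var_Lp_def)
  with f_mem show ?thesis by blast
qed

end
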